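(* For every integer $n\ge 1$, $$\sum_{k=2}^{n-1}\binom{2n}{2k-1}\frac{\left(2^{2(n-k+1)}-1\right)\left(2^{2(k-1)}-1\right)}{n-k+1}\,B_{2(n-k+1)}=\left(2^{2(n-1)}-1\right)(2-n),$$ where an empty sum is zero.
   Context: The Bernoulli numbers $B_m$ are defined by $\frac{x}{e^x-1}=\sum_{m=0}^\infty B_m\frac{x^m}{m!}$ for $|x|<2\pi$. *)

theory Defs
  imports "HOL-Complex_Analysis.Complex_Analysis"
begin

text \<open>
  The Bernoulli numbers are the coefficients in the expansion of \<open>x / (exp x - 1)\<close>.
  The point \<open>x = 0\<close> is left out because the quotient is only defined there as a limit
  (and \<open>0 / 0 = 0\<close> in HOL); the remaining points determine the coefficients, as
  \<open>bernoulli_unique\<close> shows.  In this convention \<open>B\<^sub>1 = - 1 / 2\<close>.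
\<close>

definition is_bernoulli_seq :: "(nat \<Rightarrow> real) \<Rightarrow> bool" where
  "is_bernoulli_seq B \<longleftrightarrow>
     (\<forall>x::real. x \<noteq> 0 \<and> \<bar>x\<bar> < 2 * pi \<longrightarrow> (\<lambda>m. B m * (x ^ m / fact m)) sums (x / (exp x - 1)))"

definition bernoulli :: "nat \<Rightarrow> real" where
  "bernoulli = (THE B. is_bernoulli_seq B)"

lemma is_bernoulli_seq_exists: "\<exists>B. is_bernoulli_seq B"
proof -
  define g :: "complex \<Rightarrow> complex" where "g z = (if z = 0 then 1 else (exp z - 1) / z)" for z
  have deriv_1: "deriv (\<lambda>z::complex. exp z - 1) 0 = 1"
    by (rule DERIV_imp_deriv) (auto intro!: derivative_eq_intros)
  have hol_g: "g holomorphic_on UNIV"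
  proof (rule pole_theorem_open_0[where g = "\<lambda>z. exp z - 1" and a = 0])
    show "(\<lambda>z::complex. exp z - 1) holomorphic_on UNIV"
      by (intro holomorphic_intros)
    show "g 0 = deriv (\<lambda>z. exp z - 1) 0"
      unfolding deriv_1 by (simp add: g_def)
    show "exp z - 1 = (z - 0) * g z" if "z \<in> UNIV - {0}" for z
      using that by (simp add: g_def)
  qed simp_all
  have g_nz: "g z \<noteq> 0" if "z \<in> ball 0 (2 * pi)" for z
  proof (cases "z = 0")
    case False
    have "exp z \<noteq> 1"
    proof
      assume "exp z = 1"
      then obtain n :: int where n: "Re z = 0" "Im z = of_int (2 * n) * pi"
        by (auto simp: exp_eq_1)
      with False have "n \<noteq> 0" by (auto simp: complex_eq_iff)
      then have "1 \<le> \<bar>real_of_int n\<bar>" by linarith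
      then have "2 * pi \<le> \<bar>Im z\<bar>" by (simp add: n abs_mult)
      also have "\<dots> \<le> cmod z" by (rule abs_Im_le_cmod)
      finally show False using that by simp
    qed
    with False show ?thesis by (simp add: g_def)
  qed (simp add: g_def)
  define F where "F = (\<lambda>z. 1 / g z)"
  have hol_F: "F holomorphic_on ball 0 (2 * pi)"
    unfolding F_def using g_nz
    by (intro holomorphic_intros holomorphic_on_subset[OF hol_g]) auto
  define B where "B m = Re ((deriv ^^ m) F 0)" for m
  have "(\<lambda>m. B m * (x ^ m / fact m)) sums (x / (exp x - 1))"
    if x: "x \<noteq> 0" "\<bar>x\<bar> < 2 * pi" for x :: real
  proof -
    have "(\<lambda>m. (deriv ^^ m) F 0 / fact m * (complex_of_real x - 0) ^ m) sums F (of_real x)"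
      using x by (intro holomorphic_power_series[OF hol_F]) auto
    then have "(\<lambda>m. Re ((deriv ^^ m) F 0 / fact m * of_real x ^ m)) sums Re (F (of_real x))"
      by (intro sums_Re) simp
    moreover have "Re ((deriv ^^ m) F 0 / fact m * of_real x ^ m) = B m * (x ^ m / fact m)" for m
    proof -
      have "(deriv ^^ m) F 0 / fact m * of_real x ^ m =
            (deriv ^^ m) F 0 * complex_of_real (x ^ m / fact m)" by simp
      then show ?thesis by (simp only: B_def times_complex.sel Re_complex_of_real Im_complex_of_real
              mult_zero_right diff_zero)
    qed
    moreover have "F (of_real x) = complex_of_real (x / (exp x - 1))"
      using x by (simp add: F_def g_def exp_of_real)
    ultimately show ?thesis by simp
  qed
  then show ?thesis unfolding is_bernoulli_seq_def by blast
qed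

lemma is_bernoulli_seq_unique:
  assumes "is_bernoulli_seq B" "is_bernoulli_seq C"
  shows "B = C"
proof
  fix n
  define d where "d m = (B m - C m) / fact m" for m
  have d_sums: "(\<lambda>m. d m * x ^ m) sums 0" if "x \<noteq> 0" "\<bar>x\<bar> < 2 * pi" for x
  proof -
    have "(\<lambda>m. B m * (x ^ m / fact m) - C m * (x ^ m / fact m)) sums
            (x / (exp x - 1) - x / (exp x - 1))"
      using assms that unfolding is_bernoulli_seq_def by (intro sums_diff) auto
    then show ?thesis by (simp add: d_def field_simps)
  qed
  have "d n = 0" for n
  proof (induction n rule: less_induct)
    case (less n)
    have "(\<lambda>m. d (m + n) * x ^ m) sums 0" if "x \<noteq> 0" "norm x < 2 * pi" for x
    proof -
      have "(\<lambda>m. d (m + n) * x ^ (m + n)) sums 0"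
        using d_sums[of x] that less sums_iff_shift[of "\<lambda>m. d m * x ^ m" n 0] by simp
      then have "(\<lambda>m. d (m + n) * x ^ (m + n) / x ^ n) sums (0 / x ^ n)"
        by (rule sums_divide)
      then show ?thesis using that by (simp add: power_add)
    qed
    then have lim: "((\<lambda>x::real. 0) \<longlongrightarrow> d (0 + n)) (at 0)"
      by (intro powser_limit_0_strong[where s = "2 * pi" and a = "\<lambda>m. d (m + n)"]) auto
    show ?case
      using tendsto_unique[OF trivial_limit_at lim tendsto_const] by simp
  qed
  then show "B n = C n" by (simp add: d_def)
qed

lemma bernoulli_unique:
  assumes "is_bernoulli_seq B"
  shows "bernoulli = B"
  unfolding bernoulli_def by (rule the_equality, rule assms) (rule is_bernoulli_seq_unique[OF _ assms])

lemma bernoulli_sums: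
  assumes "x \<noteq> 0" "\<bar>x\<bar> < 2 * pi"
  shows "(\<lambda>m. bernoulli m * (x ^ m / fact m)) sums (x / (exp x - 1))"
  using is_bernoulli_seq_exists bernoulli_unique assms
  by (metis is_bernoulli_seq_def)

end

theory Submission
  imports Defs
begin

text \<open>
  The convolution is a single coefficient of a product of power series.  Put
  \<open>T(x) = (x / 2) tanh (x / 2)\<close>.  Since \<open>x / (exp x - 1)\<close> has the coefficients \<open>B\<^sub>m / m!\<close> and
  \<open>2x / (exp (2x) - 1) - x / (exp x - 1) = - x / (exp x + 1) = T(x) - x / 2\<close>,
  the coefficients of \<open>T\<close> are \<open>(2^m - 1) B\<^sub>m / m!\<close> for \<open>m \<noteq> 1\<close>.  The remaining factors
  \<open>2^(2(k - 1)) - 1\<close>, divided by factorials, are up to the factor 4 the coefficients of the odd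
  function \<open>K(x) = 2 sinh (2x) - 4 sinh x\<close>; as \<open>K\<close> is odd, the odd-indexed coefficients of \<open>T\<close> do
  not contribute to the odd-indexed coefficients of \<open>T K\<close>.

  The denominator of \<open>tanh (x / 2) = (exp x - 1) / (exp x + 1)\<close> divides \<open>K\<close>, because
  \<open>K(x) = (exp x + 1) (exp x - 1)^3 exp (- 2x)\<close>.  Hence
  \<open>2 T(x) K(x) = x (exp x - 1)^4 exp (- 2x)\<close>,
  whose coefficients are explicit (\<open>tanh_times_kernel\<close>).  Comparing the coefficients of
  \<open>x^(2n + 1)\<close> gives a convolution over the even indices \<open>0, 2, \<dots>, 2n\<close>.  The extreme indices
  contribute nothing, and the index \<open>2\<close>, which the sum over \<open>k \<le> n - 1\<close> omits, contributes a
  multiple of \<open>n\<close>; it accounts for the factor \<open>2 - n\<close>.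
\<close>

section \<open>The generating function of the Bernoulli numbers as a formal power series\<close>

text \<open>
  After cancelling the leading power of the difference of two expansions, the value at \<open>0\<close> would be
  a nonzero coefficient, while the function vanishes away from \<open>0\<close>: this contradicts continuity.
\<close>

lemma has_fps_expansion_unique:
  fixes F G :: "'a :: {banach, real_normed_field} fps"
  assumes "f has_fps_expansion F" "f has_fps_expansion G"
  shows "F = G"
proof (rule ccontr)
  assume "F \<noteq> G"
  define H where "H = F - G"
  define c where "c = fps_nth H (subdegree H)"
  have "H \<noteq> 0" using \<open>F \<noteq> G\<close> by (simp add: H_def)
  then have "c \<noteq> 0" by (simp add: c_def)
  have "(\<lambda>x. f x - f x) has_fps_expansion H"
    unfolding H_def by (intro has_fps_expansion_diff assms)
  then have "(\<lambda>x. 0) has_fps_expansion H" by simp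
  from has_fps_expansion_shift[OF this order_refl c_def]
  have "(\<lambda>x. if x = 0 then c else 0) has_fps_expansion fps_shift (subdegree H) H"
    by (simp cong: if_cong)
  from has_fps_expansion_imp_continuous[OF this, of UNIV]
  have "((\<lambda>x::'a. if x = 0 then c else 0) \<longlongrightarrow> c) (at 0)"
    by (simp add: continuous_within)
  moreover have "((\<lambda>x::'a. if x = 0 then c else 0) \<longlongrightarrow> 0) (at 0)"
    by (rule tendsto_eventually) (simp add: eventually_at_filter)
  ultimately show False
    using \<open>c \<noteq> 0\<close> tendsto_unique[OF trivial_limit_at] by blast
qed

definition bernoulli_fps :: "real fps" where
  "bernoulli_fps = Abs_fps (\<lambda>m. bernoulli m / fact m)"

lemma bernoulli_fps_nth: "fps_nth bernoulli_fps m = bernoulli m / fact m"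
  by (simp add: bernoulli_fps_def)

lemma bernoulli_fps_mult: "bernoulli_fps * (fps_exp 1 - 1) = fps_X"
proof -
  \<comment> \<open>the value at \<open>0\<close> has to be the constant term of the series; it disappears in the
      product because \<open>exp x - 1\<close> vanishes there\<close>
  define f where "f x = (if x = 0 then bernoulli 0 else x / (exp x - 1))" for x :: real
  have "f has_fps_expansion bernoulli_fps"
  proof (rule has_fps_expansionI)
    have "\<forall>\<^sub>F x in nhds 0. x \<in> ball (0::real) (2 * pi)"
      by (intro eventually_nhds_in_open) auto
    then show "\<forall>\<^sub>F x in nhds 0. (\<lambda>m. fps_nth bernoulli_fps m * x ^ m) sums f x"
    proof eventually_elim
      case (elim x)
      show ?case
      proof (cases "x = 0")
        case True
        then show ?thesis
          using powser_sums_zero[of "fps_nth bernoulli_fps"] by (simp add: f_def bernoulli_fps_nth)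
      next
        case False
        then show ?thesis
          using bernoulli_sums[of x] elim by (simp add: f_def bernoulli_fps_nth)
      qed
    qed
  qed
  then have "(\<lambda>x. f x * (exp x - 1)) has_fps_expansion bernoulli_fps * (fps_exp 1 - 1)"
    by (intro fps_expansion_intros)
  moreover have "(\<lambda>x. f x * (exp x - 1)) = (\<lambda>x. x)"
    by (auto simp: f_def)
  ultimately have "(\<lambda>x. x) has_fps_expansion bernoulli_fps * (fps_exp 1 - 1)"
    by simp
  then show ?thesis
    by (rule has_fps_expansion_unique) (rule has_fps_expansion_fps_X)
qed

section \<open>The series of the hyperbolic tangent\<close>

text \<open>
  This is \<open>(x / 2) tanh (x / 2)\<close>; the added linear term cancels the only odd-order coefficient of
  the difference in the definition.
\<close>

definition tanh_fps :: "real fps" where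
  "tanh_fps = (bernoulli_fps oo (fps_const 2 * fps_X)) - bernoulli_fps + fps_const (1 / 2) * fps_X"

lemma tanh_fps_nth:
  "fps_nth tanh_fps m = (2 ^ m - 1) * bernoulli m / fact m + (if m = 1 then 1 / 2 else 0)"
  unfolding tanh_fps_def fps_add_nth fps_sub_nth fps_nth_compose_linear bernoulli_fps_nth
  by (simp add: left_diff_distrib diff_divide_distrib)

lemma fps_exp_2: "fps_exp (2::real) = fps_exp 1 ^ 2"
  using fps_exp_add_mult[of 1 "1::real"] by (simp add: power2_eq_square)

text \<open>
  Over the common denominator \<open>exp (2x) - 1 = (exp x - 1) (exp x + 1)\<close> of the two Bernoulli
  series, the factor \<open>exp x - 1\<close> cancels.
\<close>

lemma tanh_fps_mult: "2 * tanh_fps * (fps_exp 1 + 1) = fps_X * (fps_exp 1 - 1)"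
proof -
  define E :: "real fps" where "E = fps_exp 1"
  define C where "C = bernoulli_fps oo (fps_const 2 * fps_X)"
  have nz: "E - 1 \<noteq> 0"
    using bernoulli_fps_mult fps_X_neq_zero unfolding E_def by (metis mult_zero_right)
  have B: "bernoulli_fps * (E - 1) = fps_X"
    unfolding E_def by (rule bernoulli_fps_mult)
  have "C * ((E - 1) oo (fps_const 2 * fps_X)) = fps_X oo (fps_const 2 * fps_X)"
    using fps_compose_mult_distrib[of "fps_const 2 * fps_X" bernoulli_fps "E - 1"]
    by (simp add: C_def B)
  moreover have "(E - 1) oo (fps_const 2 * fps_X) = E ^ 2 - 1"
    unfolding E_def fps_exp_2[symmetric]
    by (rule fps_ext) (simp add: fps_compose_sub_distrib)
  moreover have "fps_X oo (fps_const 2 * fps_X) = 2 * (fps_X :: real fps)"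
    by (simp add: numeral_fps_const)
  ultimately have C: "C * (E ^ 2 - 1) = 2 * fps_X"
    by simp
  have "2 * fps_const (1 / 2 :: real) = 1"
    by (simp add: numeral_fps_const)
  then have T: "2 * tanh_fps = 2 * C - 2 * bernoulli_fps + fps_X"
    unfolding tanh_fps_def C_def[symmetric] by (simp add: algebra_simps flip: mult.assoc)
  have "(2 * tanh_fps * (E + 1)) * (E - 1)
      = 2 * (C * (E ^ 2 - 1)) - 2 * (bernoulli_fps * (E - 1)) * (E + 1) + fps_X * (E + 1) * (E - 1)"
    unfolding T by (simp add: algebra_simps power2_eq_square)
  also have "\<dots> = (fps_X * (E - 1)) * (E - 1)"
    unfolding B C by (simp add: algebra_simps)
  finally show ?thesis
    using nz unfolding E_def by simp
qed

lemma tanh_fps_nth_2: "fps_nth tanh_fps 2 = 1 / 4"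
proof -
  have "fps_nth (2 * tanh_fps * (fps_exp 1 + 1)) m = fps_nth (fps_X * (fps_exp 1 - 1)) m" for m
    by (simp only: tanh_fps_mult)
  from this[of 1] this[of 2] show ?thesis
    using tanh_fps_nth[of 0]
    by (simp add: fps_mult_nth numeral_fps_const eval_nat_numeral)
qed

section \<open>The convolution\<close>

definition kernel_fps :: "real fps" where
  "kernel_fps = fps_exp 2 - fps_exp (-2) - fps_const 2 * fps_exp 1 + fps_const 2 * fps_exp (-1)"

lemma kernel_fps_nth_even:
  "even i \<Longrightarrow> fps_nth kernel_fps i = 0"
  by (simp add: kernel_fps_def)

lemma kernel_fps_nth_odd:
  "fps_nth kernel_fps (Suc (2 * i)) = 4 * (2 ^ (2 * i) - 1) / fact (Suc (2 * i))"
  by (simp add: kernel_fps_def diff_divide_distrib del: fact_Suc)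

text \<open>
  With \<open>E = exp x\<close> the kernel is \<open>(E + 1) (E - 1)^3 E^(-2)\<close>, and the first factor is the
  denominator of \<open>tanh (x / 2)\<close>.
\<close>

lemma tanh_times_kernel:
  "2 * tanh_fps * kernel_fps =
     fps_X * (fps_exp 2 + fps_exp (-2) + fps_const 6 - fps_const 4 * fps_exp 1
                - fps_const 4 * fps_exp (-1))"
proof -
  define E E' :: "real fps" where "E = fps_exp 1" and "E' = fps_exp (-1)"
  have EE': "E * E' = 1"
    using fps_exp_add_mult[of 1 "-1::real"] by (simp add: E_def E'_def)
  have E2: "fps_exp 2 = E ^ 2" unfolding E_def by (rule fps_exp_2)
  have E'2: "fps_exp (-2) = E' ^ 2"
    using fps_exp_add_mult[of "-1" "-1::real"] by (simp add: E'_def power2_eq_square)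
  have factored: "kernel_fps = (E + 1) * ((E - 1) ^ 3 * E' ^ 2)"
    using EE' unfolding kernel_fps_def E2 E'2 E_def[symmetric] E'_def[symmetric]
      numeral_fps_const[symmetric]
    by algebra
  have "2 * tanh_fps * kernel_fps = (2 * tanh_fps * (E + 1)) * ((E - 1) ^ 3 * E' ^ 2)"
    unfolding factored by (simp only: mult.assoc)
  also have "\<dots> = fps_X * (E - 1) * ((E - 1) ^ 3 * E' ^ 2)"
    unfolding E_def tanh_fps_mult ..
  also have "\<dots> = fps_X * (E ^ 2 + E' ^ 2 + 6 - 4 * E - 4 * E')"
    using EE' by algebra
  finally show ?thesis
    unfolding E2 E'2 E_def[symmetric] E'_def[symmetric] numeral_fps_const[symmetric] .
qed

lemma tanh_kernel_convolution:
  assumes "n \<ge> 1"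
  shows "(\<Sum>j = 0..n. fps_nth tanh_fps (2 * j) * fps_nth kernel_fps (Suc (2 * (n - j))))
           = 4 * (2 ^ (2 * (n - 1)) - 1) / fact (2 * n)"
proof -
  let ?g = "\<lambda>m. fps_nth tanh_fps m * fps_nth kernel_fps (Suc (2 * n) - m)"
  have "(\<Sum>m = 2 * 0..Suc (2 * n). ?g m) = (\<Sum>j = 0..n. ?g (2 * j) + ?g (Suc (2 * j)))"
    by (rule sum.in_pairs)
  also have "\<dots> = (\<Sum>j = 0..n. fps_nth tanh_fps (2 * j) * fps_nth kernel_fps (Suc (2 * (n - j))))"
    by (intro sum.cong refl)
       (simp add: kernel_fps_nth_even Suc_diff_le diff_mult_distrib2)
  finally have "fps_nth (tanh_fps * kernel_fps) (Suc (2 * n)) = \<dots>"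
    by (simp add: fps_mult_nth)
  moreover have "2 * fps_nth (tanh_fps * kernel_fps) (Suc (2 * n)) = (2 * 2 ^ (2 * n) - 8) / fact (2 * n)"
  proof -
    have "2 * fps_nth (tanh_fps * kernel_fps) (Suc (2 * n))
        = fps_nth (2 * tanh_fps * kernel_fps) (Suc (2 * n))"
      by (simp add: numeral_fps_const mult.assoc)
    then show ?thesis
      unfolding tanh_times_kernel using assms by (simp add: diff_divide_distrib add_divide_distrib)
  qed
  moreover have "2 ^ (2 * n) = 4 * (2 ^ (2 * (n - 1)) :: real)"
    using assms by (cases n) auto
  ultimately show ?thesis by (simp add: field_simps)
qed

text \<open>
  The binomial coefficient absorbs the denominator: \<open>C(2n, 2j - 1) / j\<close> is
  \<open>2 (2n)! / ((2j)! (2n - 2j + 1)!)\<close>.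
\<close>

lemma summand_eq_convolution_term:
  assumes "2 \<le> j" "j \<le> n"
  shows "real ((2 * n) choose (2 * (n + 1 - j) - 1))
            * (((2 ^ (2 * j) - 1) * (2 ^ (2 * (n - j)) - 1)) / real j) * bernoulli (2 * j)
         = fact (2 * n) / 2
            * (fps_nth tanh_fps (2 * j) * fps_nth kernel_fps (Suc (2 * (n - j))))"
proof -
  define i where "i = n - j"
  obtain l where l: "j = Suc l" using assms by (cases j) auto
  have n: "n = i + j" using assms by (simp add: i_def)
  have "2 * n choose (2 * (n + 1 - j) - 1) = (2 * n choose Suc (2 * i))"
    by (simp add: n)
  also have "real \<dots> = fact (2 * n) / (fact (Suc (2 * i)) * fact (Suc (2 * l)))"
    by (subst binomial_fact) (simp_all add: n l del: fact_Suc)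
  finally have choose: "real (2 * n choose (2 * (n + 1 - j) - 1)) = \<dots>" .
  have fact: "fact (2 * j) = 2 * real j * fact (Suc (2 * l))"
    by (simp add: l algebra_simps)
  show ?thesis
    unfolding choose tanh_fps_nth kernel_fps_nth_odd fact i_def[symmetric]
    using assms by (simp add: field_simps del: fact_Suc)
qed

theorem mainTheorem10:
  fixes n :: nat
  assumes "n \<ge> 1"
  shows "(\<Sum>k = 2..n - 1.
            real ((2 * n) choose (2 * k - 1))
            * (((2 ^ (2 * (n - k + 1)) - 1) * (2 ^ (2 * (k - 1)) - 1)) / real (n - k + 1))
            * bernoulli (2 * (n - k + 1)))
         = (2 ^ (2 * (n - 1)) - 1) * (2 - real n)"
proof (cases "n = 1")
  case True
  then show ?thesis by simp
next
  case False
  with assms have n: "n \<ge> 2" by simp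
  let ?c = "\<lambda>j. fps_nth tanh_fps (2 * j) * fps_nth kernel_fps (Suc (2 * (n - j)))"
  let ?q = "2 ^ (2 * (n - 1)) - 1 :: real"
  let ?s = "\<lambda>k. real ((2 * n) choose (2 * k - 1))
            * (((2 ^ (2 * (n - k + 1)) - 1) * (2 ^ (2 * (k - 1)) - 1)) / real (n - k + 1))
            * bernoulli (2 * (n - k + 1))"
  \<comment> \<open>the index \<open>j = n - k + 1\<close> runs over the same interval in reverse\<close>
  have "(\<Sum>k = 2..n - 1. ?s k) = (\<Sum>j = 2..n - 1. ?s (n - 1 + 2 - j))"
    by (rule sum.atLeastAtMost_rev)
  also have "\<dots> = (\<Sum>j = 2..n - 1. fact (2 * n) / 2 * ?c j)"
  proof (rule sum.cong[OF refl])
    fix j assume "j \<in> {2..n - 1}"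
    then have j: "2 \<le> j" "j \<le> n" and eqs: "n - 1 + 2 - j = n + 1 - j"
      "n - (n + 1 - j) + 1 = j" "n + 1 - j - 1 = n - j" by auto
    show "?s (n - 1 + 2 - j) = fact (2 * n) / 2 * ?c j"
      unfolding eqs by (rule summand_eq_convolution_term[OF j])
  qed
  also have "\<dots> = fact (2 * n) / 2 * (\<Sum>j = 2..n - 1. ?c j)"
    by (simp only: sum_distrib_left)
  finally have lhs: "(\<Sum>k = 2..n - 1. ?s k) = fact (2 * n) / 2 * (\<Sum>j = 2..n - 1. ?c j)" .
  have "?c 0 = 0" by (simp add: tanh_fps_nth)
  moreover have "?c n = 0" using kernel_fps_nth_odd[of 0] by simp
  moreover have "?c 1 = ?q / fact (Suc (2 * (n - 1)))"
    unfolding kernel_fps_nth_odd mult_1_right tanh_fps_nth_2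
    by (simp add: field_simps del: fact_Suc)
  moreover have "(\<Sum>j = 0..n. ?c j) = ?c 0 + ?c 1 + (\<Sum>j = 2..n - 1. ?c j) + ?c n"
  proof -
    have "{0..n} = insert 0 (insert 1 (insert n {2..n - 1}))" using n by auto
    then show ?thesis using n by simp
  qed
  ultimately have sum: "(\<Sum>j = 2..n - 1. ?c j)
      = 4 * ?q / fact (2 * n) - ?q / fact (Suc (2 * (n - 1)))"
    using tanh_kernel_convolution[OF assms] by linarith
  have fact: "fact (2 * n) = 2 * real n * fact (Suc (2 * (n - 1)))"
    using assms by (cases n) (simp_all add: algebra_simps)
  have cancel: "2 * a * b / 2 * (4 * q / (2 * a * b) - q / b) = q * (2 - a)"
    if "a \<noteq> 0" "b \<noteq> 0" for a b q :: real
    using that by (simp add: field_simps)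
  show ?thesis
    unfolding lhs sum fact by (rule cancel) (use n in simp_all)
qed

end
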